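(* Let $a_n$ (for $n\ge 0$) denote the number of $n$-colour self-inverse compositions of $2n+1$. For $n\ge1$, let $b_n$ denote the number of $n$-colour self-inverse compositions of $2n$ into an even number of parts, $c_n$ the number of $n$-colour self-inverse compositions of $2n$ into an odd number of parts, and $d_n=b_n+c_n$ the number of all $n$-colour self-inverse compositions of $2n$. Then, as formal power series in $q$: (i) $\displaystyle\sum_{n=0}^{\infty}a_nq^n=\frac{1+q}{q^2-3q+1}$; (ii) $\displaystyle\sum_{n=1}^{\infty}b_nq^n=\frac{q}{q^2-3q+1}$; (iii) $\displaystyle\sum_{n=1}^{\infty}c_nq^n=\frac{2q}{q^2-3q+1}$; (iv) $\displaystyle\sum_{n=1}^{\infty}d_nq^n=\frac{3q}{q^2-3q+1}$.
   Context: An $n$-colour composition of a positive integer $N$ is a finite ordered sequence of coloured parts $(h_1)_{t_1}(h_2)_{t_2}\cdots(h_m)_{t_m}$ with each $h_i\ge 1$ an integer, $h_1+\cdots+h_m=N$, and each colour $t_i\in\{1,\dots,h_i\}$ (so a part of size $h$ comes in $h$ different colours); $m$ is its number of parts. The "$n$" in the term "$n$-colour" is part of the name and unrelated to the index $n$ of the sequences. An $n$-colour composition is self-inverse if the sequence of coloured parts read from left to right is identical with the sequence read from right to left, i.e. $h_i=h_{m+1-i}$ and $t_i=t_{m+1-i}$ for all $i$. *)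

theory Defs
  imports "HOL-Computational_Algebra.Formal_Power_Series"
begin

(* A coloured part h_t is encoded as the pair (h, t). *)

definition n_colour_compositions :: "nat \<Rightarrow> (nat \<times> nat) list set" where
  "n_colour_compositions N =
     {xs. (\<forall>(h, t) \<in> set xs. 1 \<le> h \<and> 1 \<le> t \<and> t \<le> h) \<and> sum_list (map fst xs) = N}"

definition self_inverse :: "(nat \<times> nat) list \<Rightarrow> bool" where
  "self_inverse xs \<longleftrightarrow> rev xs = xs"

definition a_seq :: "nat \<Rightarrow> nat" where
  "a_seq n = card {xs \<in> n_colour_compositions (2 * n + 1). self_inverse xs}"

(* b_seq, c_seq and d_seq are meant for n \<ge> 1; at n = 0 they would count the empty list. *)

definition b_seq :: "nat \<Rightarrow> nat" where
  "b_seq n = card {xs \<in> n_colour_compositions (2 * n). self_inverse xs \<and> even (length xs)}"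

definition c_seq :: "nat \<Rightarrow> nat" where
  "c_seq n = card {xs \<in> n_colour_compositions (2 * n). self_inverse xs \<and> odd (length xs)}"

definition d_seq :: "nat \<Rightarrow> nat" where
  "d_seq n = card {xs \<in> n_colour_compositions (2 * n). self_inverse xs}"

lemma finite_n_colour_compositions: "finite (n_colour_compositions N)"
proof (rule finite_subset)
  show "n_colour_compositions N \<subseteq> {xs. set xs \<subseteq> {..N} \<times> {..N} \<and> length xs \<le> N}"
  proof
    fix xs assume xs: "xs \<in> n_colour_compositions N"
    have "set xs \<subseteq> {..N} \<times> {..N}"
    proof
      fix p assume p: "p \<in> set xs"
      then have "fst p \<le> sum_list (map fst xs)"
        by (intro member_le_sum_list) auto
      with xs p show "p \<in> {..N} \<times> {..N}"
        by (cases p) (fastforce simp: n_colour_compositions_def)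
    qed
    moreover have "length xs \<le> sum_list (map fst xs)"
      if "\<forall>(h, t) \<in> set xs. 1 \<le> h \<and> 1 \<le> t \<and> t \<le> h"
      using that by (induction xs) auto
    ultimately show "xs \<in> {xs. set xs \<subseteq> {..N} \<times> {..N} \<and> length xs \<le> N}"
      using xs by (auto simp: n_colour_compositions_def)
  qed
qed (simp add: finite_lists_length_le)

lemma d_seq_eq: "d_seq n = b_seq n + c_seq n"
  unfolding b_seq_def c_seq_def d_seq_def
  by (subst card_Un_disjoint [symmetric])
     (auto simp: finite_n_colour_compositions intro!: arg_cong [of _ _ card])

(* The power series \<Sum>n\<ge>1. f n * q^n, without a constant term. *)
definition fps_from_1 :: "(nat \<Rightarrow> 'a::zero) \<Rightarrow> 'a fps" where
  "fps_from_1 f = Abs_fps (\<lambda>n. if n \<ge> 1 then f n else 0)"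

end

theory Submission
  imports Defs
begin

text \<open>
  A palindrome is determined by its first half together with its middle entry, if there is one.
  Write \<open>C j\<close> for the number of all compositions of \<open>j\<close>, and let
  \<open>P = \<Sum>j. C j * q^j\<close> and \<open>W = \<Sum>h. h * q^h\<close>; the series \<open>W\<close> counts single coloured parts.

  Splitting off the first part of a nonempty composition gives \<open>P = 1 + P * W\<close>.  Since
  \<open>W * (1 - q)^2 = q\<close>, this yields \<open>P * (q^2 - 3 * q + 1) = (1 - q)^2\<close>, which is where the common
  denominator comes from.

  A palindrome of even length with sum \<open>2 * n\<close> is \<open>ys @ rev ys\<close> for an arbitrary composition \<open>ys\<close>
  of \<open>n\<close>, so \<open>b_n = C n\<close> and the series of the \<open>b_n\<close> is \<open>P - 1 = P * W\<close>.  A palindrome of odd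
  length is \<open>ys @ p # rev ys\<close>, where \<open>p\<close> is a coloured part of size \<open>N - 2 * j\<close> if the total is
  \<open>N\<close> and \<open>ys\<close> has sum \<open>j\<close>.  There are \<open>N - 2 * j\<close> colours for \<open>p\<close>; with \<open>N = 2 * n\<close> this number is
  \<open>2 * (n - j)\<close>, and the series is \<open>2 * P * W\<close>.  With \<open>N = 2 * n + 1\<close> it is \<open>2 * (n - j) + 1\<close>, and
  the series is \<open>P * (\<Sum>k. (2 * k + 1) * q^k) = P * (1 + q) / (1 - q)^2\<close>; palindromes of even
  length do not occur there, because their sum is even.
\<close>

section \<open>Splitting compositions\<close>

definition coloured_parts :: "nat \<Rightarrow> (nat \<times> nat) set" where
  "coloured_parts h = {h} \<times> {1..h}"

lemma card_coloured_parts: "card (coloured_parts h) = h"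
  by (simp add: coloured_parts_def)

lemma finite_coloured_parts: "finite (coloured_parts h)"
  by (simp add: coloured_parts_def)

lemma Nil_in_n_colour_compositions_iff: "[] \<in> n_colour_compositions N \<longleftrightarrow> N = 0"
  by (auto simp: n_colour_compositions_def)

lemma Cons_in_n_colour_compositions_iff:
  "p # ys \<in> n_colour_compositions N \<longleftrightarrow>
     (\<exists>j\<le>N. p \<in> coloured_parts (N - j) \<and> ys \<in> n_colour_compositions j)"
  by (cases p) (auto simp: n_colour_compositions_def coloured_parts_def)

lemma n_colour_compositions_sum_unique:
  "xs \<in> n_colour_compositions i \<Longrightarrow> xs \<in> n_colour_compositions j \<Longrightarrow> i = j"
  by (simp add: n_colour_compositions_def)

lemma append_rev_in_n_colour_compositions_iff:
  "ys @ rev ys \<in> n_colour_compositions (2 * n) \<longleftrightarrow> ys \<in> n_colour_compositions n"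
  by (auto simp: n_colour_compositions_def rev_map [symmetric])

lemma append_Cons_rev_in_n_colour_compositions_iff:
  "ys @ p # rev ys \<in> n_colour_compositions N \<longleftrightarrow>
     (\<exists>j\<le>N div 2. p \<in> coloured_parts (N - 2 * j) \<and> ys \<in> n_colour_compositions j)"
  by (cases p) (auto simp: n_colour_compositions_def coloured_parts_def rev_map [symmetric])

text \<open>
  This count serves both decompositions of a list into a part and a remaining composition: the
  map \<open>g\<close> is either \<open>(#)\<close> or the insertion of the part between a list and its reverse.
\<close>

lemma card_part_and_composition:
  assumes inj: "\<And>p p' ys ys'. g p ys = g p' ys' \<Longrightarrow> p = p' \<and> ys = ys'"
  shows "card {g p ys |p ys. \<exists>j\<le>n. p \<in> coloured_parts (f j) \<and> ys \<in> n_colour_compositions j} =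
    (\<Sum>j\<le>n. card (n_colour_compositions j) * f j)"
proof -
  let ?S = "\<lambda>j. (\<lambda>(ys, p). g p ys) ` (n_colour_compositions j \<times> coloured_parts (f j))"
  have "{g p ys |p ys. \<exists>j\<le>n. p \<in> coloured_parts (f j) \<and> ys \<in> n_colour_compositions j} =
      (\<Union>j\<le>n. ?S j)"
    by force
  also have "card \<dots> = (\<Sum>j\<le>n. card (?S j))"
    by (intro card_UN_disjoint)
      (auto simp: finite_n_colour_compositions finite_coloured_parts
        dest!: inj dest: n_colour_compositions_sum_unique)
  also have "\<dots> = (\<Sum>j\<le>n. card (n_colour_compositions j) * f j)"
    by (intro sum.cong refl, subst card_image)
      (auto simp: inj_on_def card_cartesian_product card_coloured_parts dest!: inj)
  finally show ?thesis .
qed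

text \<open>
  Here \<open>j\<close> is the sum of the composition that remains after the first part.  The summand with
  \<open>j = N\<close> vanishes, in accordance with a part of size \<open>0\<close> having no colour; keeping it makes the
  right-hand side a full convolution.
\<close>

lemma card_n_colour_compositions_rec:
  assumes "N > 0"
  shows "card (n_colour_compositions N) = (\<Sum>j\<le>N. card (n_colour_compositions j) * (N - j))"
proof -
  have "n_colour_compositions N =
      {p # ys |p ys. \<exists>j\<le>N. p \<in> coloured_parts (N - j) \<and> ys \<in> n_colour_compositions j}"
    (is "_ = ?R")
  proof (rule set_eqI)
    fix xs
    show "xs \<in> n_colour_compositions N \<longleftrightarrow> xs \<in> ?R"
      using assms
      by (cases xs) (auto simp: Nil_in_n_colour_compositions_iff Cons_in_n_colour_compositions_iff)
  qed
  then show ?thesis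
    by (simp only:) (rule card_part_and_composition, simp)
qed

section \<open>Halving palindromes\<close>

lemma even_palindrome_iff:
  "self_inverse xs \<and> even (length xs) \<longleftrightarrow> (\<exists>ys. xs = ys @ rev ys)"
proof
  assume xs: "self_inverse xs \<and> even (length xs)"
  define k where "k = length xs div 2"
  have "drop k xs = rev (take k xs)"
    using xs by (auto simp: rev_take self_inverse_def k_def elim!: evenE)
  then show "\<exists>ys. xs = ys @ rev ys"
    by (metis append_take_drop_id)
qed (auto simp: self_inverse_def)

lemma odd_palindrome_iff:
  "self_inverse xs \<and> odd (length xs) \<longleftrightarrow> (\<exists>ys p. xs = ys @ p # rev ys)"
proof
  assume xs: "self_inverse xs \<and> odd (length xs)"
  define k where "k = length xs div 2"
  have "k < length xs"
    using xs by (auto simp: k_def elim!: oddE)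
  moreover have "drop (Suc k) xs = rev (take k xs)"
    using xs by (auto simp: rev_take self_inverse_def k_def elim!: oddE)
  ultimately show "\<exists>ys p. xs = ys @ p # rev ys"
    by (metis id_take_nth_drop)
qed (auto simp: self_inverse_def)

text \<open>
  The index \<open>j\<close> is the sum of the half to the left of the middle part, so the middle part has size
  \<open>N - 2 * j\<close> and as many colours.
\<close>

lemma card_odd_palindromes:
  "card {xs \<in> n_colour_compositions N. self_inverse xs \<and> odd (length xs)} =
     (\<Sum>j\<le>N div 2. card (n_colour_compositions j) * (N - 2 * j))"
proof -
  have "{xs \<in> n_colour_compositions N. self_inverse xs \<and> odd (length xs)} =
      {ys @ p # rev ys |p ys.
        \<exists>j\<le>N div 2. p \<in> coloured_parts (N - 2 * j) \<and> ys \<in> n_colour_compositions j}"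
    unfolding odd_palindrome_iff append_Cons_rev_in_n_colour_compositions_iff [symmetric] by blast
  then show ?thesis
  proof (simp only:, intro card_part_and_composition)
    fix p p' :: "nat \<times> nat" and ys ys'
    assume eq: "ys @ p # rev ys = ys' @ p' # rev ys'"
    then have "length ys = length ys'"
      by (auto dest!: arg_cong [of _ _ length])
    with eq show "p = p' \<and> ys = ys'"
      by simp
  qed
qed

lemma odd_length_if_odd_palindrome_sum:
  assumes "xs \<in> n_colour_compositions (2 * n + 1)" "self_inverse xs"
  shows "odd (length xs)"
proof
  assume "even (length xs)"
  with assms obtain ys where "xs = ys @ rev ys"
    using even_palindrome_iff by blast
  with assms(1) have "2 * sum_list (map fst ys) = 2 * n + 1"
    by (simp add: n_colour_compositions_def rev_map [symmetric])
  then show False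
    by presburger
qed

lemma a_seq_eq: "a_seq n = (\<Sum>j\<le>n. card (n_colour_compositions j) * (2 * (n - j) + 1))"
proof -
  have "a_seq n =
      card {xs \<in> n_colour_compositions (2 * n + 1). self_inverse xs \<and> odd (length xs)}"
    unfolding a_seq_def using odd_length_if_odd_palindrome_sum by (metis (no_types, lifting))
  also have "\<dots> = (\<Sum>j\<le>n. card (n_colour_compositions j) * (2 * (n - j) + 1))"
    unfolding card_odd_palindromes
    by (intro sum.cong) (auto simp: Suc_diff_le diff_mult_distrib2)
  finally show ?thesis .
qed

lemma b_seq_eq: "b_seq n = card (n_colour_compositions n)"
proof -
  have "{xs \<in> n_colour_compositions (2 * n). self_inverse xs \<and> even (length xs)} =
      (\<lambda>ys. ys @ rev ys) ` n_colour_compositions n"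
    unfolding even_palindrome_iff by (auto simp: append_rev_in_n_colour_compositions_iff)
  moreover have "inj (\<lambda>ys :: (nat \<times> nat) list. ys @ rev ys)"
  proof (rule injI)
    fix ys ys' :: "(nat \<times> nat) list"
    assume eq: "ys @ rev ys = ys' @ rev ys'"
    then have "length ys = length ys'"
      by (auto dest!: arg_cong [of _ _ length])
    with eq show "ys = ys'"
      by simp
  qed
  ultimately show ?thesis
    unfolding b_seq_def by (simp add: card_image inj_on_subset)
qed

lemma c_seq_eq: "c_seq n = (\<Sum>j\<le>n. card (n_colour_compositions j) * (2 * (n - j)))"
  unfolding c_seq_def card_odd_palindromes by (intro sum.cong) auto

section \<open>Generating functions\<close>

definition composition_fps :: "rat fps" where
  "composition_fps = Abs_fps (\<lambda>n. of_nat (card (n_colour_compositions n)))"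

definition part_fps :: "rat fps" where
  "part_fps = Abs_fps of_nat"

lemma composition_fps_times_nth:
  "fps_nth (composition_fps * Abs_fps (\<lambda>k. of_nat (w k))) n =
     of_nat (\<Sum>j\<le>n. card (n_colour_compositions j) * w (n - j))"
  by (simp add: fps_mult_nth composition_fps_def atLeast0AtMost)

lemma part_fps_eq: "part_fps * (1 - fps_X) ^ 2 = fps_X"
proof -
  have "part_fps * (1 - fps_X) = Abs_fps (\<lambda>n. if n = 0 then 0 else 1)"
    by (rule fps_ext) (auto simp: part_fps_def algebra_simps of_nat_diff)
  moreover have "Abs_fps (\<lambda>n. if n = 0 then 0 else 1) * (1 - fps_X) = (fps_X :: rat fps)"
    by (rule fps_ext) (auto simp: algebra_simps)
  ultimately show ?thesis
    by (metis mult.assoc power2_eq_square)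
qed

lemma odd_numbers_fps_eq:
  "Abs_fps (\<lambda>k. of_nat (2 * k + 1)) * (1 - fps_X) ^ 2 = (1 + fps_X :: rat fps)"
proof -
  have "Abs_fps (\<lambda>k. of_nat (2 * k + 1)) * (1 - fps_X) =
      (Abs_fps (\<lambda>n. if n = 0 then 1 else 2) :: rat fps)"
    by (rule fps_ext) (auto simp: algebra_simps of_nat_diff)
  moreover have "Abs_fps (\<lambda>n. if n = 0 then 1 else 2) * (1 - fps_X) = (1 + fps_X :: rat fps)"
    by (rule fps_ext) (auto simp: algebra_simps)
  ultimately show ?thesis
    by (metis mult.assoc power2_eq_square)
qed

text \<open>
  The summand \<open>1\<close> is the empty composition, the only one without a first part.
\<close>

lemma composition_fps_rec: "composition_fps = 1 + composition_fps * part_fps"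
proof (rule fps_ext)
  fix n
  have *: "fps_nth (composition_fps * part_fps) n =
      of_nat (\<Sum>j\<le>n. card (n_colour_compositions j) * (n - j))"
    using composition_fps_times_nth [of "\<lambda>k. k" n] by (simp add: part_fps_def)
  show "fps_nth composition_fps n = fps_nth (1 + composition_fps * part_fps) n"
  proof (cases "n = 0")
    case True
    have "n_colour_compositions 0 = {[]}"
    proof (rule set_eqI)
      fix xs
      show "xs \<in> n_colour_compositions 0 \<longleftrightarrow> xs \<in> {[]}"
        by (cases xs) (auto simp: Nil_in_n_colour_compositions_iff
          Cons_in_n_colour_compositions_iff coloured_parts_def)
    qed
    with True * show ?thesis
      by (simp add: composition_fps_def)
  next
    case False
    have "fps_nth composition_fps n = of_nat (card (n_colour_compositions n))"
      by (simp add: composition_fps_def)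
    also have "\<dots> = fps_nth (composition_fps * part_fps) n"
      unfolding * using False by (subst card_n_colour_compositions_rec) simp_all
    finally show ?thesis
      using False by simp
  qed
qed

text \<open>
  The denominator \<open>q^2 - 3 * q + 1\<close> is \<open>(1 - W) * (1 - q)^2\<close> with \<open>W\<close> the series of single parts,
  and \<open>1 - W\<close> is the inverse of the series of all compositions.
\<close>

lemma composition_fps_eq: "composition_fps * (fps_X ^ 2 - 3 * fps_X + 1) = (1 - fps_X) ^ 2"
proof -
  have "fps_X ^ 2 - 3 * fps_X + 1 = (1 - part_fps) * (1 - fps_X) ^ 2"
    using part_fps_eq by (simp add: algebra_simps power2_eq_square)
  moreover have "composition_fps * (1 - part_fps) = 1"
    using composition_fps_rec by (simp add: algebra_simps)
  ultimately show ?thesis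
    by (metis mult.assoc mult_1)
qed

lemma composition_part_fps_eq:
  "composition_fps * part_fps * (fps_X ^ 2 - 3 * fps_X + 1) = fps_X"
proof -
  have "composition_fps * part_fps * (fps_X ^ 2 - 3 * fps_X + 1) =
      part_fps * (composition_fps * (fps_X ^ 2 - 3 * fps_X + 1))"
    by (simp only: mult.assoc mult.left_commute)
  then show ?thesis
    by (simp only: composition_fps_eq part_fps_eq)
qed

lemma a_fps_eq:
  "Abs_fps (\<lambda>n. of_nat (a_seq n)) = composition_fps * Abs_fps (\<lambda>k. of_nat (2 * k + 1))"
  by (rule fps_ext) (simp only: composition_fps_times_nth a_seq_eq fps_nth_Abs_fps)

text \<open>
  Starting the sum at \<open>1\<close> drops the empty palindrome, which is what passing from the series of all
  compositions to that of the nonempty ones does.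
\<close>

lemma b_fps_eq: "fps_from_1 (\<lambda>n. of_nat (b_seq n)) = composition_fps * part_fps"
proof -
  have "composition_fps * part_fps = composition_fps - 1"
    using composition_fps_rec by (simp add: algebra_simps)
  moreover have "fps_nth (composition_fps * part_fps) 0 = 0"
    by (simp add: part_fps_def)
  ultimately show ?thesis
    by (intro fps_ext) (auto simp: fps_from_1_def b_seq_eq composition_fps_def Suc_le_eq)
qed

lemma c_fps_eq: "fps_from_1 (\<lambda>n. of_nat (c_seq n)) = 2 * (composition_fps * part_fps)"
proof -
  have "2 * part_fps = Abs_fps (\<lambda>k. of_nat (2 * k))"
    by (rule fps_ext) (simp add: part_fps_def numeral_fps_const)
  then have "2 * (composition_fps * part_fps) = composition_fps * Abs_fps (\<lambda>k. of_nat (2 * k))"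
    by (simp only: mult.left_commute)
  moreover have "fps_from_1 (\<lambda>n. of_nat (c_seq n)) = Abs_fps (\<lambda>n. of_nat (c_seq n) :: rat)"
    by (rule fps_ext) (auto simp: fps_from_1_def c_seq_eq Suc_le_eq)
  ultimately show ?thesis
    by (intro fps_ext) (simp only: composition_fps_times_nth c_seq_eq fps_nth_Abs_fps)
qed

lemma d_fps_eq: "fps_from_1 (\<lambda>n. of_nat (d_seq n)) = 3 * (composition_fps * part_fps)"
proof -
  have "fps_from_1 (\<lambda>n. of_nat (d_seq n)) =
      fps_from_1 (\<lambda>n. of_nat (b_seq n)) + (fps_from_1 (\<lambda>n. of_nat (c_seq n)) :: rat fps)"
    by (rule fps_ext) (simp add: fps_from_1_def d_seq_eq)
  then show ?thesis
    by (simp add: b_fps_eq c_fps_eq)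
qed

theorem theorem4p1:
  "let q = fps_X :: rat fps in
     Abs_fps (\<lambda>n. of_nat (a_seq n)) = (1 + q) / (q ^ 2 - 3 * q + 1) \<and>
     fps_from_1 (\<lambda>n. of_nat (b_seq n)) = q / (q ^ 2 - 3 * q + 1) \<and>
     fps_from_1 (\<lambda>n. of_nat (c_seq n)) = 2 * q / (q ^ 2 - 3 * q + 1) \<and>
     fps_from_1 (\<lambda>n. of_nat (d_seq n)) = 3 * q / (q ^ 2 - 3 * q + 1)"
proof -
  define D :: "rat fps" where "D = fps_X ^ 2 - 3 * fps_X + 1"
  have "D \<noteq> 0"
    using composition_part_fps_eq by (auto simp: D_def)
  then have quotient: "f = g / D" if "f * D = g" for f g
    unfolding that [symmetric] by simp
  have "composition_fps * Abs_fps (\<lambda>k. of_nat (2 * k + 1)) * D =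
      Abs_fps (\<lambda>k. of_nat (2 * k + 1)) * (composition_fps * D)"
    by (simp only: mult.assoc mult.left_commute)
  then have a: "composition_fps * Abs_fps (\<lambda>k. of_nat (2 * k + 1)) * D = 1 + fps_X"
    by (simp only: D_def composition_fps_eq odd_numbers_fps_eq)
  have b: "composition_fps * part_fps * D = fps_X"
    by (simp only: D_def composition_part_fps_eq)
  then have bs: "k * (composition_fps * part_fps) * D = k * fps_X" for k
    by (simp only: mult.assoc)
  show ?thesis
    unfolding Let_def D_def [symmetric] a_fps_eq b_fps_eq c_fps_eq d_fps_eq
    by (intro conjI quotient a b bs)
qed

end
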